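(* Let $G$ be a $T_1$ topological locally compact fan loop for which there exists a compact subgroup $N_0=N_0(G)$ in $N(G)$ such that $t(a,b,c)\in N_0$ and $p(a,b,c)\in N_0$ for all $a,b,c\in G$. Let $\mu:\mathcal B(G)\to[0,\infty]$ be a regular $\sigma$-additive measure on the Borel $\sigma$-algebra $\mathcal B(G)$ of $G$ such that $\mu(U)>0$ for each nonempty open subset $U$ of $G$, $\mu(A)<\infty$ for each compact subset $A$ of $G$, and $\mu(bB)=\mu(B)$ for each $B\in\mathcal B(G)$ and $b\in G$, where $bB=\{bx:x\in B\}$. Then $\mu(G)<\infty$ if and only if $G$ is compact.
   Context: A loop is a set $G$ with a binary multiplication such that for all $a,b\in G$ there is a unique $x$ with $ax=b$ (written $x=a\backslash b$) and a unique $y$ with $ya=b$ (written $y=b/a$), and there is $e\in G$ with $eg=ge=g$ for all $g$. The nucleus is $N(G)=\{a\in G:\ (ab)c=a(bc),\ (ba)c=b(ac),\ (bc)a=b(ca)\ \text{for all } b,c\in G\}$; it is a group. A fan loop is a loop such that for all $a,b,c\in G$ there are $t(a,b,c),p(a,b,c)\in N(G)$ with $(ab)c=t(a,b,c)\,(a(bc))$ and $(ab)c=(a(bc))\,p(a,b,c)$ (these elements are then unique). A topological fan loop is a fan loop with a topology for which multiplication, $(a,b)\mapsto a\backslash b$ and $(a,b)\mapsto b/a$ are jointly continuous. The fan $N_0(G)$ is the minimal closed subgroup of $G$ containing all $t(a,b,c)$ and $p(a,b,c)$. Regular means: $\mu(U)=\sup\{\mu(X): X\text{ compact},\ X\subset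 U\}$ for each open $U\subset G$, and $\mu(A)=\inf\{\mu(V): V\text{ open},\ A\subset V\subset G\}$ for each $A\in\mathcal B(G)$. *)

theory Defs
  imports "HOL-Analysis.Analysis" "HOL-Algebra.Group"
begin

text \<open>The underlying set of a loop is a whole type, so that the loop can carry a topology
  through the type class \<^class>\<open>topological_space\<close>.\<close>

locale loop =
  fixes mult :: "'a \<Rightarrow> 'a \<Rightarrow> 'a" (infixl "\<cdot>" 70)
  assumes ex1_left: "\<exists>!x. a \<cdot> x = b"
    and ex1_right: "\<exists>!y. y \<cdot> a = b"
    and ex_unit: "\<exists>e. \<forall>g. e \<cdot> g = g \<and> g \<cdot> e = g"
begin

definition e :: 'a
  where "e = (THE e. \<forall>g. e \<cdot> g = g \<and> g \<cdot> e = g)"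

text \<open>\<open>ldiv a b\<close> is $a \backslash b$ and \<open>rdiv b a\<close> is $b / a$.\<close>

definition ldiv :: "'a \<Rightarrow> 'a \<Rightarrow> 'a"
  where "ldiv a b = (THE x. a \<cdot> x = b)"

definition rdiv :: "'a \<Rightarrow> 'a \<Rightarrow> 'a"
  where "rdiv b a = (THE y. y \<cdot> a = b)"

definition nucleus :: "'a set"
  where "nucleus = {a. \<forall>b c. (a \<cdot> b) \<cdot> c = a \<cdot> (b \<cdot> c) \<and>
                              (b \<cdot> a) \<cdot> c = b \<cdot> (a \<cdot> c) \<and>
                              (b \<cdot> c) \<cdot> a = b \<cdot> (c \<cdot> a)}"

text \<open>A subgroup of a loop is a subset that is a group (in particular associative) under the
  restricted multiplication. Its unit is necessarily that of the loop, because an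
  idempotent of a loop equals the unit.\<close>

definition is_subgroup :: "'a set \<Rightarrow> bool"
  where "is_subgroup H \<longleftrightarrow> group \<lparr>carrier = H, monoid.mult = (\<cdot>), one = e\<rparr>"

lemma e_mult: "e \<cdot> g = g" and mult_e: "g \<cdot> e = g"
proof -
  have "\<exists>!u. \<forall>g. u \<cdot> g = g \<and> g \<cdot> u = g"
    using ex_unit by metis
  then have "\<forall>g. e \<cdot> g = g \<and> g \<cdot> e = g"
    unfolding e_def by (rule theI')
  then show "e \<cdot> g = g" "g \<cdot> e = g" by auto
qed

lemma mult_ldiv: "a \<cdot> ldiv a b = b"
  unfolding ldiv_def using ex1_left by (rule theI')

lemma rdiv_mult: "rdiv b a \<cdot> a = b"
  unfolding rdiv_def using ex1_right by (rule theI')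

end

locale fan_loop = loop +
  assumes ex_t: "\<exists>t\<in>nucleus. (a \<cdot> b) \<cdot> c = t \<cdot> (a \<cdot> (b \<cdot> c))"
    and ex_p: "\<exists>p\<in>nucleus. (a \<cdot> b) \<cdot> c = (a \<cdot> (b \<cdot> c)) \<cdot> p"
begin

definition t :: "'a \<Rightarrow> 'a \<Rightarrow> 'a \<Rightarrow> 'a"
  where "t a b c = (THE t. t \<in> nucleus \<and> (a \<cdot> b) \<cdot> c = t \<cdot> (a \<cdot> (b \<cdot> c)))"

definition p :: "'a \<Rightarrow> 'a \<Rightarrow> 'a \<Rightarrow> 'a"
  where "p a b c = (THE p. p \<in> nucleus \<and> (a \<cdot> b) \<cdot> c = (a \<cdot> (b \<cdot> c)) \<cdot> p)"

lemma t_spec: "t a b c \<in> nucleus \<and> (a \<cdot> b) \<cdot> c = t a b c \<cdot> (a \<cdot> (b \<cdot> c))"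
  unfolding t_def by (rule theI') (metis ex_t ex1_right)

lemma p_spec: "p a b c \<in> nucleus \<and> (a \<cdot> b) \<cdot> c = (a \<cdot> (b \<cdot> c)) \<cdot> p a b c"
  unfolding p_def by (rule theI') (metis ex_p ex1_left)

end

locale topological_fan_loop = fan_loop mult
  for mult :: "'a::topological_space \<Rightarrow> 'a \<Rightarrow> 'a" (infixl "\<cdot>" 70) +
  assumes continuous_mult: "continuous_on UNIV (\<lambda>(a, b). a \<cdot> b)"
    and continuous_ldiv: "continuous_on UNIV (\<lambda>(a, b). ldiv a b)"
    and continuous_rdiv: "continuous_on UNIV (\<lambda>(a, b). rdiv b a)"
begin

definition fan :: "'a set"
  where "fan = (\<lambda>H. closed H \<and> is_subgroup H) hull {x. \<exists>a b c. x = t a b c \<or> x = p a b c}"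

end

definition regular_borel_measure :: "'a::topological_space measure \<Rightarrow> bool"
  where "regular_borel_measure \<mu> \<longleftrightarrow>
    sets \<mu> = sets borel \<and>
    (\<forall>U. open U \<longrightarrow> emeasure \<mu> U = (SUP X\<in>{X. compact X \<and> X \<subseteq> U}. emeasure \<mu> X)) \<and>
    (\<forall>A\<in>sets borel. emeasure \<mu> A = (INF V\<in>{V. open V \<and> A \<subseteq> V}. emeasure \<mu> V))"

end

theory Submission
  imports Defs
begin

text \<open>
  A compact set has finite measure by hypothesis; the content is the converse. Let \<open>U\<close> be an open
  neighbourhood of the unit that is contained in a compact set \<open>K\<close>. All left translates of \<open>U\<close> have
  the same positive measure, so when the total measure is finite there is a bound on the number of
  translates of \<open>U\<close> that are pairwise disjoint, and a largest such family
  \<open>b\<^sub>1U, \<dots>, b\<^sub>nU\<close> meets every translate (lemma \<open>finite_family_meeting_all\<close>). For arbitrary \<open>b\<close> this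
  gives \<open>b \<cdot> x = b\<^sub>i \<cdot> y\<close> with \<open>x, y \<in> U\<close>. In a group one would conclude
  \<open>b = b\<^sub>i y x\<^sup>-\<^sup>1\<close>; in a loop right division does the same job without any associativity, since
  \<open>b = (b\<^sub>i \<cdot> y) / x\<close>. The whole loop is thus the union of finitely many sets
  \<open>{(b\<^sub>i \<cdot> y) / x | x y. x, y \<in> K}\<close>, each of which is a continuous image of the compact set
  \<open>K \<times> K\<close>.

  The packing uses translates of \<open>U\<close> rather than of \<open>K\<close> because left translations are
  homeomorphisms, so these sets are open and hence Borel, whereas compact sets are known to be
  Borel only after the Hausdorff property has been established.
\<close>

text \<open>Counting volumes bounds the size of a pairwise disjoint subfamily, so one of largest size
  exists. A member disjoint from all of it would be nonempty, hence new, and could be added.\<close>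

lemma (in finite_measure) finite_family_meeting_all:
  fixes T :: "'i \<Rightarrow> 'a set"
  assumes sets: "\<And>i. T i \<in> sets M"
    and r: "0 < r" "\<And>i. r \<le> measure M (T i)"
  obtains F where "finite F" "\<And>i. \<exists>j\<in>F. T i \<inter> T j \<noteq> {}"
proof -
  define P where "P F \<longleftrightarrow> finite F \<and> disjoint_family_on T F" for F
  obtain n where n: "measure M (space M) < real n * r"
    using reals_Archimedean3[OF r(1)] by blast
  have bound: "card F < n" if "P F" for F
  proof -
    have "real (card F) * r \<le> (\<Sum>i\<in>F. measure M (T i))"
      using sum_bounded_below[of F r] r(2) by simp
    also have "\<dots> = measure M (\<Union>i\<in>F. T i)"
      using that sets by (intro finite_measure_finite_Union[symmetric]) (auto simp: P_def)
    also have "\<dots> \<le> measure M (space M)"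
      by (rule bounded_measure)
    finally show ?thesis
      using n r(1) by (smt (verit) mult_right_mono of_nat_le_iff not_less)
  qed
  have "P {}"
    by (simp add: P_def disjoint_family_on_def)
  then obtain F where F: "P F" and greatest: "\<And>F'. P F' \<Longrightarrow> card F' \<le> card F"
    using ex_has_greatest_nat[of P "{}" card n] bound by (metis less_imp_le)
  have "\<exists>j\<in>F. T i \<inter> T j \<noteq> {}" for i
  proof (rule ccontr)
    assume none: "\<not> (\<exists>j\<in>F. T i \<inter> T j \<noteq> {})"
    have "T i \<noteq> {}"
      using r(1) r(2)[of i] by force
    with none have "i \<notin> F"
      by blast
    moreover have "P (insert i F)"
      using F none by (auto simp: P_def disjoint_family_on_def)
    ultimately show False
      using greatest[of "insert i F"] F by (simp add: P_def)
  qed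
  with F show thesis
    by (intro that[of F]) (auto simp: P_def)
qed

context loop
begin

lemma ldiv_mult: "ldiv a (a \<cdot> x) = x"
  using ex1_left mult_ldiv by metis

lemma mult_rdiv: "rdiv (y \<cdot> a) a = y"
  using ex1_right rdiv_mult by metis

end

context topological_fan_loop
begin

lemma open_left_translate:
  assumes "open U"
  shows "open ((\<cdot>) b ` U)"
proof -
  have "(\<cdot>) b ` U = ldiv b -` U"
  proof
    show "(\<cdot>) b ` U \<subseteq> ldiv b -` U"
      by (auto simp: ldiv_mult)
    show "ldiv b -` U \<subseteq> (\<cdot>) b ` U"
    proof
      fix x assume "x \<in> ldiv b -` U"
      then show "x \<in> (\<cdot>) b ` U"
        using mult_ldiv[of b x] by (metis imageI vimageD)
    qed
  qed
  moreover have "continuous_on UNIV (\<lambda>x. ldiv b x)"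
    using continuous_on_compose2[OF continuous_ldiv, of UNIV "\<lambda>x. (b, x)"]
    by (simp add: continuous_intros)
  ultimately show ?thesis
    using assms by (simp add: open_vimage)
qed

text \<open>The set below consists of those \<open>b\<close> for which the translates of \<open>K\<close> by \<open>b\<close> and by \<open>c\<close> meet.\<close>

lemma compact_translate_quotient:
  assumes "compact K"
  shows "compact ((\<lambda>(x, y). rdiv (c \<cdot> y) x) ` (K \<times> K))"
proof (rule compact_continuous_image)
  have "continuous_on UNIV (\<lambda>z. c \<cdot> snd z)"
    using continuous_on_compose2[OF continuous_mult, of UNIV "\<lambda>z. (c, snd z)"]
    by (simp add: continuous_intros)
  then have "continuous_on UNIV (\<lambda>z. (fst z, c \<cdot> snd z))"
    by (intro continuous_intros)
  from continuous_on_compose2[OF continuous_rdiv this]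
  show "continuous_on (K \<times> K) (\<lambda>(x, y). rdiv (c \<cdot> y) x)"
    by (auto simp: case_prod_unfold intro: continuous_on_subset)
  show "compact (K \<times> K)"
    using assms by (intro compact_Times)
qed

lemma compact_if_finite_left_invariant_measure:
  fixes \<mu> :: "'a measure"
  assumes U: "open U" "U \<noteq> {}" "U \<subseteq> K" and K: "compact K"
    and sets: "sets \<mu> = sets borel"
    and pos: "0 < emeasure \<mu> U"
    and inv: "\<And>b. emeasure \<mu> ((\<cdot>) b ` U) = emeasure \<mu> U"
    and fin: "emeasure \<mu> UNIV < \<infinity>"
  shows "compact (UNIV :: 'a set)"
proof -
  have "space \<mu> = UNIV"
    using sets_eq_imp_space_eq[OF sets] by simp
  with fin interpret finite_measure \<mu>
    by (intro finite_measureI) simp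
  have "0 < measure \<mu> U"
    using pos by (simp add: emeasure_eq_measure)
  moreover have "(\<cdot>) b ` U \<in> sets \<mu>" for b
    using open_left_translate[OF U(1)] by (simp add: sets)
  moreover have "measure \<mu> U \<le> measure \<mu> ((\<cdot>) b ` U)" for b
    by (simp add: measure_def inv)
  ultimately obtain F where F: "finite F" "\<And>b. \<exists>c\<in>F. (\<cdot>) b ` U \<inter> (\<cdot>) c ` U \<noteq> {}"
    using finite_family_meeting_all[of "\<lambda>b. (\<cdot>) b ` U" "measure \<mu> U"] by blast
  let ?Q = "\<lambda>c. (\<lambda>(x, y). rdiv (c \<cdot> y) x) ` (K \<times> K)"
  have "b \<in> (\<Union>c\<in>F. ?Q c)" for b
  proof -
    obtain c x y where "c \<in> F" "x \<in> U" "y \<in> U" "b \<cdot> x = c \<cdot> y"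
      using F(2)[of b] by blast
    moreover from this have "b = rdiv (c \<cdot> y) x"
      by (metis mult_rdiv)
    ultimately show ?thesis
      using U(3) by force
  qed
  then have "UNIV = (\<Union>c\<in>F. ?Q c)"
    by blast
  moreover have "compact (\<Union>c\<in>F. ?Q c)"
    using F(1) compact_translate_quotient[OF K] by (intro compact_UN) auto
  ultimately show ?thesis
    by simp
qed

end

theorem theorem3p19:
  fixes mult :: "'a::t1_space \<Rightarrow> 'a \<Rightarrow> 'a"
    and N0 :: "'a set"
    and \<mu> :: "'a measure"
  assumes "topological_fan_loop mult"
    and "locally_compact_space (euclidean :: 'a topology)"
    and "N0 = topological_fan_loop.fan mult"
    and "loop.is_subgroup mult N0"
    and "compact N0"
    and "N0 \<subseteq> loop.nucleus mult"
    and "\<And>a b c. fan_loop.t mult a b c \<in> N0"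
    and "\<And>a b c. fan_loop.p mult a b c \<in> N0"
    and "regular_borel_measure \<mu>"
    and "\<And>U. open U \<Longrightarrow> U \<noteq> {} \<Longrightarrow> emeasure \<mu> U > 0"
    and "\<And>A. compact A \<Longrightarrow> emeasure \<mu> A < \<infinity>"
    and "\<And>B b. B \<in> sets borel \<Longrightarrow> emeasure \<mu> (mult b ` B) = emeasure \<mu> B"
  shows "emeasure \<mu> UNIV < \<infinity> \<longleftrightarrow> compact (UNIV :: 'a set)"
proof
  assume fin: "emeasure \<mu> UNIV < \<infinity>"
  interpret topological_fan_loop mult
    by (rule assms(1))
  obtain U K where "open U" "compact K" "e \<in> U" "U \<subseteq> K"
    using assms(2) unfolding locally_compact_space_def
    by simp metis
  moreover have "sets \<mu> = sets borel"
    using assms(9) by (simp add: regular_borel_measure_def)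
  ultimately show "compact (UNIV :: 'a set)"
    using assms(10,12) fin
    by (intro compact_if_finite_left_invariant_measure[of U K \<mu>]) auto
next
  assume "compact (UNIV :: 'a set)"
  then show "emeasure \<mu> UNIV < \<infinity>"
    by (rule assms(11))
qed

end
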